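(* Let $(N,(A_i)_{i\in N},(u_i)_{i\in N})$ be a finite strategic game with player set $N=\{1,\dots,n\}$, and let $S_{\mathrm{pu}},S_{\mathrm{nc}},S_{\mathrm{co}}\subset\mathbb{R}^n$ be its pure-payoff region, noncooperative payoff region and cooperative payoff region, respectively. Then $$\varnothing\neq \operatorname{ext}(S_{\mathrm{co}})\subseteq \operatorname{ext}(S_{\mathrm{nc}})\subseteq S_{\mathrm{pu}}.$$
   Context: A finite strategic game $(N,(A_i)_{i\in N},(u_i)_{i\in N})$ consists of a player set $N=\{1,\dots,n\}$, for each $i\in N$ a nonempty finite set $A_i$ of pure strategies, and payoff functions $u_i\colon\prod_{j\in N}A_j\to\mathbb{R}$; put $u=(u_1,\dots,u_n)\colon\prod_{j\in N}A_j\to\mathbb{R}^n$. For a nonempty finite set $X$, $\Delta(X)$ is the set of probability distributions on $X$. For a correlated strategy $\varphi\in\Delta(\prod_{i\in N}A_i)$ set $u(\varphi)=\sum_{a\in\prod_{i\in N}A_i}\varphi(a)\,u(a)$. For a mixed-strategy profile $\sigma=(\sigma_1,\dots,\sigma_n)\in\prod_{i\in N}\Delta(A_i)$ set $u(\sigma)=\sum_{a\in\prod_{i\in N}A_i}\big(\prod_{i\in N}\sigma_i(a_i)\big)u(a)$. The payoff regions are $S_{\mathrm{pu}}=u(\prod_{i\in N}A_i)$ (pure-payoff region), $S_{\mathrm{nc}}=u(\prod_{i\in N}\Delta(A_i))$ (noncooperative payoff region), $S_{\mathrm{co}}=u(\Delta(\prod_{i\in N}A_i))$ (cooperative payoff region).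 Extreme points of a (not necessarily convex) nonempty set $S\subseteq\mathbb{R}^n$: a point $x\in S$ is an extreme point of $S$ if, whenever $y,z\in S$ satisfy $x\in\{\theta y+(1-\theta)z\mid\theta\in(0,1)\}\subset S$, then $x=y=z$. (So only segments contained in $S$ are considered.) $\operatorname{ext}(S)$ denotes the set of all extreme points of $S$. *)

theory Defs
  imports "HOL-Probability.Probability"
begin

text \<open>
  A finite strategic game with \<open>n\<close> players: the players are the elements of a finite type \<open>'n\<close>,
  so that payoff vectors live in \<open>real ^ 'n\<close>. The strategy sets \<open>A i\<close> are arbitrary sets in a
  common ambient type \<open>'a\<close>, which need not be finite, and may differ from player to player.
  Values of \<open>u i\<close> outside the pure-strategy profiles are never used.
\<close>

definition finite_game :: "('n::finite \<Rightarrow> 'a set) \<Rightarrow> bool" where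
  "finite_game A \<longleftrightarrow> (\<forall>i. finite (A i) \<and> A i \<noteq> {})"

definition pure_profiles :: "('n::finite \<Rightarrow> 'a set) \<Rightarrow> ('n \<Rightarrow> 'a) set" where
  "pure_profiles A = (\<Pi>\<^sub>E i\<in>UNIV. A i)"

definition distributions :: "'a set \<Rightarrow> 'a pmf set" where
  "distributions X = {p. set_pmf p \<subseteq> X}"

definition correlated_strategies :: "('n::finite \<Rightarrow> 'a set) \<Rightarrow> ('n \<Rightarrow> 'a) pmf set" where
  "correlated_strategies A = distributions (pure_profiles A)"

definition mixed_profiles :: "('n::finite \<Rightarrow> 'a set) \<Rightarrow> ('n \<Rightarrow> 'a pmf) set" where
  "mixed_profiles A = (\<Pi>\<^sub>E i\<in>UNIV. distributions (A i))"

definition payoff :: "('n::finite \<Rightarrow> ('n \<Rightarrow> 'a) \<Rightarrow> real) \<Rightarrow> ('n \<Rightarrow> 'a) \<Rightarrow> real ^ 'n" where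
  "payoff u a = (\<chi> i. u i a)"

definition correlated_payoff ::
  "('n::finite \<Rightarrow> 'a set) \<Rightarrow> ('n \<Rightarrow> ('n \<Rightarrow> 'a) \<Rightarrow> real) \<Rightarrow> ('n \<Rightarrow> 'a) pmf \<Rightarrow> real ^ 'n" where
  "correlated_payoff A u \<phi> = (\<Sum>a\<in>pure_profiles A. pmf \<phi> a *\<^sub>R payoff u a)"

definition mixed_payoff ::
  "('n::finite \<Rightarrow> 'a set) \<Rightarrow> ('n \<Rightarrow> ('n \<Rightarrow> 'a) \<Rightarrow> real) \<Rightarrow> ('n \<Rightarrow> 'a pmf) \<Rightarrow> real ^ 'n" where
  "mixed_payoff A u \<sigma> = (\<Sum>a\<in>pure_profiles A. (\<Prod>i\<in>UNIV. pmf (\<sigma> i) (a i)) *\<^sub>R payoff u a)"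

definition S_pu :: "('n::finite \<Rightarrow> 'a set) \<Rightarrow> ('n \<Rightarrow> ('n \<Rightarrow> 'a) \<Rightarrow> real) \<Rightarrow> (real ^ 'n) set" where
  "S_pu A u = payoff u ` pure_profiles A"

definition S_nc :: "('n::finite \<Rightarrow> 'a set) \<Rightarrow> ('n \<Rightarrow> ('n \<Rightarrow> 'a) \<Rightarrow> real) \<Rightarrow> (real ^ 'n) set" where
  "S_nc A u = mixed_payoff A u ` mixed_profiles A"

definition S_co :: "('n::finite \<Rightarrow> 'a set) \<Rightarrow> ('n \<Rightarrow> ('n \<Rightarrow> 'a) \<Rightarrow> real) \<Rightarrow> (real ^ 'n) set" where
  "S_co A u = correlated_payoff A u ` correlated_strategies A"

text \<open>
  Extreme points of a set that need not be convex. Unlike \<^const>\<open>extreme_point_of\<close>, only segments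
  contained in \<open>S\<close> are considered. The segment is written out because \<^const>\<open>open_segment\<close> is
  empty when its endpoints coincide.
\<close>

definition ext :: "'v::real_vector set \<Rightarrow> 'v set" where
  "ext S = {x \<in> S. \<forall>y\<in>S. \<forall>z\<in>S.
     x \<in> {\<theta> *\<^sub>R y + (1 - \<theta>) *\<^sub>R z | \<theta>::real. \<theta> \<in> {0<..<1}} \<and>
     {\<theta> *\<^sub>R y + (1 - \<theta>) *\<^sub>R z | \<theta>::real. \<theta> \<in> {0<..<1}} \<subseteq> S
     \<longrightarrow> x = y \<and> y = z}"

end

theory Submission
  imports Defs
begin

text \<open>
  The cooperative region is the polytope spanned by the pure payoffs, so its extreme points exist
  and are pure payoffs; they stay extreme in the smaller region \<open>S_nc\<close>, which contains them.
  For the last inclusion, fix all players but one: the payoff is affine in the remaining player's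
  mixed strategy, so his deviations sweep out a polytope inside \<open>S_nc\<close>. An extreme point of \<open>S_nc\<close>
  in this polytope is one of its vertices, so that player may be assumed to play a pure strategy.
  Treating the players one after the other makes the whole profile pure.
\<close>

text \<open>Names the set written out in \<open>ext\<close>, so that equal endpoints (a singleton)
  and distinct endpoints (the usual open segment) can be handled apart.\<close>

definition segment :: "'v::real_vector \<Rightarrow> 'v \<Rightarrow> 'v set" where
  "segment y z = {\<theta> *\<^sub>R y + (1 - \<theta>) *\<^sub>R z | \<theta>::real. \<theta> \<in> {0<..<1}}"

lemma ext_iff:
  "x \<in> ext S \<longleftrightarrow> x \<in> S \<and> (\<forall>y\<in>S. \<forall>z\<in>S. x \<in> segment y z \<and> segment y z \<subseteq> S \<longrightarrow> x = y \<and> y = z)"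
  unfolding ext_def segment_def mem_Collect_eq ..

lemma ext_subset: "ext S \<subseteq> S"
  by (simp add: subset_iff ext_iff)

text \<open>Shrinking the set leaves fewer segments inside it, hence fewer conditions on
  \<open>x\<close>. This serves twice: to pass from \<open>S_co\<close> to \<open>S_nc\<close>, and
  from \<open>S_nc\<close> to a polytope of deviations.\<close>

lemma ext_antimono:
  assumes "x \<in> ext S" "x \<in> T" "T \<subseteq> S"
  shows "x \<in> ext T"
  using assms unfolding ext_iff by blast

lemma segment_refl: "segment x x = {x}"
  using dense[of "0::real" 1] by (auto simp: segment_def simp flip: scaleR_add_left)

lemma segment_eq_open_segment:
  assumes "y \<noteq> z"
  shows "segment y z = open_segment y z"
  \<comment> \<open>\<open>in_segment\<close> puts its parameter on the second endpoint,
    \<open>segment\<close> on the first; hence the swap.\<close>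
  unfolding open_segment_commute[of y z] set_eq_iff in_segment segment_def mem_Collect_eq
  using assms by (simp add: add.commute) blast

lemma segment_subset_convex:
  assumes "convex S" "y \<in> S" "z \<in> S"
  shows "segment y z \<subseteq> S"
  using assms by (auto simp: segment_def intro!: convexD)

text \<open>Convexity puts every segment between members inside \<open>S\<close>, so the notion
  agrees with the usual one and facts about polytopes apply.\<close>

lemma ext_convex:
  assumes "convex S"
  shows "ext S = {x. x extreme_point_of S}"
proof -
  have "(x \<in> segment y z \<and> segment y z \<subseteq> S \<longrightarrow> x = y \<and> y = z) \<longleftrightarrow> x \<notin> open_segment y z"
    if "y \<in> S" "z \<in> S" for x y z
    using segment_subset_convex[OF assms that]
    by (cases "y = z") (simp_all add: segment_refl segment_eq_open_segment)
  then show ?thesis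
    by (simp add: set_eq_iff ext_iff extreme_point_of_def)
qed

text \<open>Expectations are convex combinations; conversely, point masses yield the generators and
  mixtures yield convexity. Applied both to correlated strategies and to the mixed strategies of a
  single player.\<close>

lemma pmf_expectations_eq_convex_hull:
  fixes f :: "'a \<Rightarrow> 'v::real_vector"
  assumes "finite X"
  shows "(\<lambda>p. \<Sum>a\<in>X. pmf p a *\<^sub>R f a) ` distributions X = convex hull (f ` X)"
proof
  show "(\<lambda>p. \<Sum>a\<in>X. pmf p a *\<^sub>R f a) ` distributions X \<subseteq> convex hull (f ` X)"
  proof (rule image_subsetI)
    fix p assume "p \<in> distributions X"
    then have "(\<Sum>a\<in>X. pmf p a) = 1"
      using assms by (intro sum_pmf_eq_1) (auto simp: distributions_def)
    then show "(\<Sum>a\<in>X. pmf p a *\<^sub>R f a) \<in> convex hull (f ` X)"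
      using assms by (intro convex_sum) (auto intro: hull_inc)
  qed
next
  let ?E = "\<lambda>p. \<Sum>a\<in>X. pmf p a *\<^sub>R f a"
  show "convex hull (f ` X) \<subseteq> ?E ` distributions X"
  proof (rule hull_minimal)
    show "f ` X \<subseteq> ?E ` distributions X"
    proof (rule image_subsetI)
      fix a assume a: "a \<in> X"
      have "?E (return_pmf a) = (\<Sum>b\<in>X. if b = a then f b else 0)"
        by (intro sum.cong) auto
      then have E: "f a = ?E (return_pmf a)"
        using a assms by simp
      have "return_pmf a \<in> distributions X"
        using a by (simp add: distributions_def)
      with E show "f a \<in> ?E ` distributions X"
        by (rule image_eqI)
    qed
    show "convex (?E ` distributions X)"
      unfolding convex_alt
    proof safe
      fix p q :: "'a pmf" and t :: real
      assume pq: "p \<in> distributions X" "q \<in> distributions X" and t: "0 \<le> t" "t \<le> 1"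
      \<comment> \<open>Draw from \<open>q\<close> with probability \<open>t\<close> and from
        \<open>p\<close> otherwise.\<close>
      define r where "r = bind_pmf (bernoulli_pmf t) (\<lambda>b. if b then q else p)"
      have "pmf r a = (1 - t) * pmf p a + t * pmf q a" for a
        using t by (simp add: r_def pmf_bind)
      then have E: "(1 - t) *\<^sub>R ?E p + t *\<^sub>R ?E q = ?E r"
        by (simp add: scaleR_sum_right scaleR_add_left sum.distrib)
      have "r \<in> distributions X"
        using pq by (auto simp: distributions_def r_def split: if_splits)
      with E show "(1 - t) *\<^sub>R ?E p + t *\<^sub>R ?E q \<in> ?E ` distributions X"
        by (rule image_eqI)
    qed
  qed
qed

lemma finite_pure_profiles: "finite_game A \<Longrightarrow> finite (pure_profiles A)"
  by (auto simp: finite_game_def pure_profiles_def intro: finite_PiE)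

lemma S_co_eq_convex_hull:
  assumes "finite_game A"
  shows "S_co A u = convex hull (S_pu A u)"
  unfolding S_co_def S_pu_def correlated_strategies_def correlated_payoff_def
  by (rule pmf_expectations_eq_convex_hull[OF finite_pure_profiles[OF assms]])

lemma S_nc_subset_S_co:
  assumes "finite_game A"
  shows "S_nc A u \<subseteq> S_co A u"
  unfolding S_nc_def
proof (rule image_subsetI)
  fix \<sigma> assume \<sigma>: "\<sigma> \<in> mixed_profiles A"
  have "(\<Sum>b\<in>A i. pmf (\<sigma> i) b) = 1" for i
    using \<sigma> assms by (intro sum_pmf_eq_1) (auto simp: mixed_profiles_def distributions_def finite_game_def)
  \<comment> \<open>Expanding the product of the total masses, each equal to 1, shows that the
    product weights sum to 1.\<close>
  moreover have "(\<Prod>i\<in>UNIV. \<Sum>b\<in>A i. pmf (\<sigma> i) b) = (\<Sum>a\<in>pure_profiles A. \<Prod>i\<in>UNIV. pmf (\<sigma> i) (a i))"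
    unfolding pure_profiles_def using assms by (intro prod_sum_PiE) (auto simp: finite_game_def)
  ultimately have "(\<Sum>a\<in>pure_profiles A. \<Prod>i\<in>UNIV. pmf (\<sigma> i) (a i)) = 1"
    by simp
  then show "mixed_payoff A u \<sigma> \<in> S_co A u"
    unfolding mixed_payoff_def S_co_eq_convex_hull[OF assms] S_pu_def
    by (intro convex_sum) (auto simp: finite_pure_profiles assms intro: hull_inc prod_nonneg)
qed

lemma mixed_payoff_return_pmf:
  assumes "finite_game A" "a \<in> pure_profiles A"
  shows "mixed_payoff A u (\<lambda>i. return_pmf (a i)) = payoff u a"
proof -
  have "(\<Prod>i\<in>UNIV. pmf (return_pmf (a i)) (b i)) = (if b = a then 1 else 0)" for b :: "'a \<Rightarrow> 'b"
  proof (cases "b = a")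
    case False
    \<comment> \<open>Here \<open>ext\<close> is the fact of function extensionality, not the set of
      extreme points.\<close>
    then obtain i where "a i \<noteq> b i" by (metis ext)
    then have "pmf (return_pmf (a i)) (b i) = 0" by simp
    then have "(\<Prod>i\<in>UNIV. pmf (return_pmf (a i)) (b i)) = 0"
      by (intro prod_zero) auto
    with False show ?thesis by simp
  qed simp
  then have "mixed_payoff A u (\<lambda>i. return_pmf (a i)) = (\<Sum>b\<in>pure_profiles A. if b = a then payoff u b else 0)"
    unfolding mixed_payoff_def by (intro sum.cong) auto
  then show ?thesis
    using assms by (simp add: finite_pure_profiles)
qed

lemma S_pu_subset_S_nc:
  assumes "finite_game A"
  shows "S_pu A u \<subseteq> S_nc A u"
  unfolding S_pu_def
proof (rule image_subsetI)
  fix a assume a: "a \<in> pure_profiles A"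
  then have "(\<lambda>i. return_pmf (a i)) \<in> mixed_profiles A"
    by (auto simp: mixed_profiles_def distributions_def pure_profiles_def PiE_iff)
  with mixed_payoff_return_pmf[OF assms a, symmetric] show "payoff u a \<in> S_nc A u"
    unfolding S_nc_def by (rule image_eqI)
qed

text \<open>The payoff is linear in the weights of player \<open>i\<close>, and \<open>p\<close> is
  the mixture of its point masses.\<close>

lemma mixed_payoff_fun_upd:
  assumes "finite_game A"
  shows "mixed_payoff A u (\<sigma>(i := p)) = (\<Sum>b\<in>A i. pmf p b *\<^sub>R mixed_payoff A u (\<sigma>(i := return_pmf b)))"
proof -
  \<comment> \<open>The joint weight of the other players, which a change of
    \<open>\<sigma> i\<close> leaves alone.\<close>
  define R where "R a = (\<Prod>j\<in>UNIV - {i}. pmf (\<sigma> j) (a j))" for a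
  have split: "(\<Prod>j\<in>UNIV. pmf ((\<sigma>(i := q)) j) (a j)) = pmf q (a i) * R a" for q a
    unfolding R_def by (subst prod.remove[of _ i]) (auto intro!: arg_cong2[of _ _ _ _ "(*)"] prod.cong)
  have "(\<Sum>b\<in>A i. pmf p b *\<^sub>R mixed_payoff A u (\<sigma>(i := return_pmf b)))
      = (\<Sum>a\<in>pure_profiles A. \<Sum>b\<in>A i. (pmf p b * (pmf (return_pmf b) (a i) * R a)) *\<^sub>R payoff u a)"
    unfolding mixed_payoff_def split
    by (simp add: scaleR_sum_right) (rule sum.swap)
  \<comment> \<open>Only the point mass at \<open>b = a i\<close> contributes to the inner
    sum.\<close>
  also have "\<dots> = (\<Sum>a\<in>pure_profiles A. (pmf p (a i) * R a) *\<^sub>R payoff u a)"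
  proof (rule sum.cong)
    fix a assume "a \<in> pure_profiles A"
    then have "a i \<in> A i" by (auto simp: pure_profiles_def)
    moreover have "(\<Sum>b\<in>A i. (pmf p b * (pmf (return_pmf b) (a i) * R a)) *\<^sub>R payoff u a)
        = (\<Sum>b\<in>A i. if b = a i then (pmf p b * R a) *\<^sub>R payoff u a else 0)"
      by (intro sum.cong) (auto simp: indicator_def)
    ultimately show "(\<Sum>b\<in>A i. (pmf p b * (pmf (return_pmf b) (a i) * R a)) *\<^sub>R payoff u a)
        = (pmf p (a i) * R a) *\<^sub>R payoff u a"
      using assms by (simp add: finite_game_def)
  qed simp
  finally show ?thesis
    unfolding mixed_payoff_def split ..
qed

lemma ext_S_nc_deviation:
  assumes "finite_game A" "\<sigma> \<in> mixed_profiles A" "mixed_payoff A u \<sigma> \<in> ext (S_nc A u)"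
  obtains b where "b \<in> A i" "mixed_payoff A u (\<sigma>(i := return_pmf b)) = mixed_payoff A u \<sigma>"
proof -
  \<comment> \<open>All payoffs that player \<open>i\<close> can reach by deviating alone.\<close>
  define C where "C = (\<lambda>p. mixed_payoff A u (\<sigma>(i := p))) ` distributions (A i)"
  have "C = (\<lambda>p. \<Sum>b\<in>A i. pmf p b *\<^sub>R mixed_payoff A u (\<sigma>(i := return_pmf b))) ` distributions (A i)"
    unfolding C_def by (intro image_cong refl mixed_payoff_fun_upd assms(1))
  also have "\<dots> = convex hull ((\<lambda>b. mixed_payoff A u (\<sigma>(i := return_pmf b))) ` A i)"
    using assms(1) by (intro pmf_expectations_eq_convex_hull) (simp add: finite_game_def)
  finally have "C = convex hull ((\<lambda>b. mixed_payoff A u (\<sigma>(i := return_pmf b))) ` A i)" .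
  moreover have "C \<subseteq> S_nc A u"
    using assms(2) by (auto simp: C_def S_nc_def mixed_profiles_def PiE_iff intro!: imageI)
  \<comment> \<open>Deviating to \<open>\<sigma> i\<close> itself changes nothing, so the extreme
    payoff lies in \<open>C\<close>.\<close>
  moreover have "mixed_payoff A u (\<sigma>(i := \<sigma> i)) \<in> C"
    unfolding C_def using assms(2) by (intro imageI) (auto simp: mixed_profiles_def)
  ultimately have "mixed_payoff A u \<sigma> extreme_point_of
      (convex hull ((\<lambda>b. mixed_payoff A u (\<sigma>(i := return_pmf b))) ` A i))"
    using ext_antimono[OF assms(3), of C] by (auto simp: ext_convex)
  then show thesis
    using extreme_point_of_convex_hull that by fastforce
qed

lemma ext_S_nc_subset_S_pu:
  assumes "finite_game A"
  shows "ext (S_nc A u) \<subseteq> S_pu A u"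
proof
  fix x assume x: "x \<in> ext (S_nc A u)"
  \<comment> \<open>\<open>F\<close> collects the players already made pure. The payoff stays
    exactly \<open>x\<close>, so extremality is available again for the next player.\<close>
  have "\<exists>\<sigma>\<in>mixed_profiles A. mixed_payoff A u \<sigma> = x \<and> (\<forall>i\<in>F. \<exists>b\<in>A i. \<sigma> i = return_pmf b)"
    if "finite F" for F
    using that
  proof (induction F)
    case empty
    then show ?case using x ext_subset by (fastforce simp: S_nc_def)
  next
    case (insert i F)
    then obtain \<sigma> where \<sigma>: "\<sigma> \<in> mixed_profiles A" "mixed_payoff A u \<sigma> = x"
      "\<forall>j\<in>F. \<exists>b\<in>A j. \<sigma> j = return_pmf b" by blast
    with x obtain b where b: "b \<in> A i" "mixed_payoff A u (\<sigma>(i := return_pmf b)) = x"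
      using ext_S_nc_deviation[OF assms, of \<sigma> u i] by metis
    have "\<sigma>(i := return_pmf b) \<in> mixed_profiles A"
      using \<sigma>(1) b(1) by (auto simp: mixed_profiles_def distributions_def PiE_iff)
    moreover have "\<forall>j\<in>insert i F. \<exists>c\<in>A j. (\<sigma>(i := return_pmf b)) j = return_pmf c"
      using \<sigma>(3) b(1) by auto
    ultimately show ?case using b(2) by blast
  qed
  from this[of UNIV] obtain \<sigma> where \<sigma>: "mixed_payoff A u \<sigma> = x" "\<forall>i. \<exists>b\<in>A i. \<sigma> i = return_pmf b"
    by auto
  then obtain a where a: "\<forall>i. a i \<in> A i" "\<forall>i. \<sigma> i = return_pmf (a i)"
    by metis
  then have "\<sigma> = (\<lambda>i. return_pmf (a i))" "a \<in> pure_profiles A"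
    by (auto simp: pure_profiles_def)
  with \<sigma>(1) mixed_payoff_return_pmf[OF assms, of a u] show "x \<in> S_pu A u"
    by (auto simp: S_pu_def)
qed

theorem theorem3p5:
  fixes A :: "'n::finite \<Rightarrow> 'a set"
    and u :: "'n \<Rightarrow> ('n \<Rightarrow> 'a) \<Rightarrow> real"
  assumes "finite_game A"
  shows "{} \<noteq> ext (S_co A u) \<and> ext (S_co A u) \<subseteq> ext (S_nc A u) \<and> ext (S_nc A u) \<subseteq> S_pu A u"
proof (intro conjI ext_S_nc_subset_S_pu assms)
  have ext_co: "ext (S_co A u) = {x. x extreme_point_of (convex hull (S_pu A u))}"
    unfolding S_co_eq_convex_hull[OF assms] by (intro ext_convex convex_convex_hull)
  have "pure_profiles A \<noteq> {}"
    using assms by (auto simp: pure_profiles_def finite_game_def PiE_eq_empty_iff)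
  then have "S_pu A u \<noteq> {}" "finite (S_pu A u)"
    using finite_pure_profiles[OF assms] by (auto simp: S_pu_def)
  \<comment> \<open>The hull of a finite set is compact, and a nonempty compact convex set has an
    extreme point.\<close>
  then obtain x where "x extreme_point_of (convex hull (S_pu A u))"
    using extreme_point_exists_convex[of "convex hull (S_pu A u)"]
    by (auto simp: finite_imp_compact compact_convex_hull)
  then show "{} \<noteq> ext (S_co A u)"
    unfolding ext_co by blast
  \<comment> \<open>Extreme points of a hull are generators, here pure payoffs, and these lie in
    \<open>S_nc\<close>; \<open>ext_antimono\<close> then applies.\<close>
  have "ext (S_co A u) \<subseteq> S_nc A u"
    using S_pu_subset_S_nc[OF assms] unfolding ext_co by (auto dest!: extreme_point_of_convex_hull)
  then show "ext (S_co A u) \<subseteq> ext (S_nc A u)"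
    using ext_antimono[OF _ _ S_nc_subset_S_co[OF assms]] by blast
qed

end
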